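(* Let $n\ge2$, let $A'$ be a real symmetric invertible $(n-1)\times(n-1)$ matrix and let $b\in\mathbb{R}\setminus\{0\}$. Let $\Omega\subset\mathbb{R}^{n-1}$ be open, let $q:\Omega\to\mathbb{R}$ be smooth, and let $S=\{(y',q(y')):y'\in\Omega\}\subset\mathbb{R}^n$. Let $\mathcal{R}:\mathcal{E}'(\mathbb{R}^n\setminus S)\to\mathcal{D}'(\Omega\times(0,\infty))$ be the Radon transform over the surfaces $$\{x\in\mathbb{R}^n:\ t-(x'-y')^TA'(x'-y')-b\,(x_n-q(y'))=0\},\qquad (y',t)\in\Omega\times(0,\infty),$$ with centers on $S$, i.e. $$\mathcal{R}f(y',t)=\int_{\mathbb{R}}\int_{\mathbb{R}^n}|\nabla_x\psi|\,f(x)\,e^{i\psi(y',t,x,\omega)}\,dx\,d\omega,\qquad \psi(y',t,x,\omega)=\omega\big(t-(x'-y')^TA'(x'-y')-b(x_n-q(y'))\big),$$ where $x=(x',x_n)$ with $x'\in\mathbb{R}^{n-1}$. Then $\mathcal{R}$ satisfies the Bolker condition.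
   Context: Points of Euclidean space are regarded as column vectors; the integral defining $\mathcal{R}$ is understood as an oscillatory integral. The canonical relation of $\mathcal{R}$ is $C=\{(y',t,d_{y'}\psi,\omega;\,x,-d_x\psi):\ \partial_\omega\psi=0,\ \omega\neq0\}$, that is $$C=\Big\{\big(y',t,\omega(2A'(x'-y')+b\nabla q(y')),\omega;\ x,\ \omega\,(2A'(x'-y'),\,b)\big):\ y'\in\Omega,\ t=(x'-y')^TA'(x'-y')+b(x_n-q(y'))>0,\ x\in\mathbb{R}^n\setminus S,\ \omega\ne0\Big\},$$ a smooth $2n$-dimensional manifold parametrized by $(y',x,\omega)$. The left projection $\pi_L:C\to T^*(\Omega\times(0,\infty))$ is $\pi_L(y',x,\omega)=\big(y',\,t,\,\omega(2A'(x'-y')+b\nabla q(y')),\,\omega\big)$ with $t=(x'-y')^TA'(x'-y')+b(x_n-q(y'))$. $\mathcal{R}$ (equivalently, its canonical relation $C$) satisfies the Bolker condition if $\pi_L$ is an injective immersion. *)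

theory Defs
  imports "HOL-Analysis.Analysis"
begin

primrec Ck_on :: "nat \<Rightarrow> ('a::real_normed_vector \<Rightarrow> 'b::real_normed_vector) \<Rightarrow> 'a set \<Rightarrow> bool" where
  "Ck_on 0 f U \<longleftrightarrow> continuous_on U f"
| "Ck_on (Suc k) f U \<longleftrightarrow>
     (\<forall>x\<in>U. f differentiable (at x)) \<and> (\<forall>v. Ck_on k (\<lambda>x. frechet_derivative f (at x) v) U)"

definition smooth_on :: "('a::real_normed_vector \<Rightarrow> 'b::real_normed_vector) \<Rightarrow> 'a set \<Rightarrow> bool" where
  "smooth_on f U \<longleftrightarrow> open U \<and> (\<forall>k. Ck_on k f U)"

text \<open>
  Velocities at \<open>p\<close> of curves in \<open>M\<close>. For an embedded submanifold \<open>M\<close> of a Euclidean space this is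
  the usual tangent space, and the curves need no regularity away from the parameter value 0.
\<close>

definition tangent_space :: "'a::real_normed_vector set \<Rightarrow> 'a \<Rightarrow> 'a set" where
  "tangent_space M p =
     {v. \<exists>\<gamma>. \<gamma> 0 = p \<and> (\<forall>s::real. \<gamma> s \<in> M) \<and> (\<gamma> has_vector_derivative v) (at 0)}"

definition immersion_on ::
  "'a::real_normed_vector set \<Rightarrow> ('a \<Rightarrow> 'b::real_normed_vector) \<Rightarrow> bool" where
  "immersion_on M f \<longleftrightarrow>
     (\<exists>U. M \<subseteq> U \<and> smooth_on f U) \<and>
     (\<forall>p\<in>M. inj_on (frechet_derivative f (at p)) (tangent_space M p))"

definition gradient :: "('a::real_inner \<Rightarrow> real) \<Rightarrow> 'a \<Rightarrow> 'a" where
  "gradient f x = (THE d. GDERIV f x :> d)"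

text \<open>
  An oscillatory integral operator, given by its data, with a one-dimensional phase variable: it maps
  distributions on \<open>source_dom\<close> to distributions on \<open>target_dom\<close>.
\<close>

record ('y, 'x) osc_operator =
  target_dom :: "'y set"
  source_dom :: "'x set"
  phase :: "'y \<Rightarrow> 'x \<Rightarrow> real \<Rightarrow> real"
  amplitude :: "'y \<Rightarrow> 'x \<Rightarrow> real \<Rightarrow> real"

text \<open>
  The operator given by the data. The integral of
  \<open>amplitude \<cdot> f(x) \<cdot> exp(i \<cdot> phase)\<close> over \<open>x\<close> and \<open>\<omega>\<close> is oscillatory: it is paired with
  a test function \<open>\<phi>\<close> on \<open>target_dom\<close>, whose integral is taken first and makes the integral over
  \<open>\<omega>\<close> converge (for the phases considered here the \<open>y\<close>-derivative of the phase does not vanish when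
  \<open>\<omega> \<noteq> 0\<close>). The compactly supported distribution \<open>f\<close>, a linear functional on smooth functions, is
  then applied in the variable \<open>x\<close>.
\<close>

definition osc_apply ::
  "('y::euclidean_space, 'x) osc_operator \<Rightarrow> (('x \<Rightarrow> complex) \<Rightarrow> complex) \<Rightarrow> (('y \<Rightarrow> complex) \<Rightarrow> complex)"
  where
  "osc_apply R f \<phi> =
     f (\<lambda>x. LINT \<omega>|lborel. (LINT y:target_dom R|lborel.
              complex_of_real (amplitude R y x \<omega>) * exp (\<i> * complex_of_real (phase R y x \<omega>)) * \<phi> y))"

text \<open>
  Cotangent vectors are pairs of a base point and a covector, the latter identified with a column
  vector through the inner product.
\<close>

definition canonical_relation ::
  "('y::real_inner, 'x::real_inner) osc_operator \<Rightarrow> (('y \<times> 'y) \<times> ('x \<times> 'x)) set" where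
  "canonical_relation R =
     {((y, gradient (\<lambda>y. phase R y x \<omega>) y), (x, - gradient (\<lambda>x. phase R y x \<omega>) x)) | y x \<omega>.
        y \<in> target_dom R \<and> x \<in> source_dom R \<and> \<omega> \<noteq> 0 \<and>
        ((\<lambda>\<omega>. phase R y x \<omega>) has_real_derivative 0) (at \<omega>)}"

definition left_projection :: "('y \<times> 'y) \<times> ('x \<times> 'x) \<Rightarrow> 'y \<times> 'y" where
  "left_projection = fst"

definition bolker_condition :: "('y::real_inner, 'x::real_inner) osc_operator \<Rightarrow> bool" where
  "bolker_condition R \<longleftrightarrow>
     inj_on left_projection (canonical_relation R) \<and>
     immersion_on (canonical_relation R) left_projection"

text \<open>
  Below, \<open>n = CARD('n) + 1 \<ge> 2\<close>; points of the Euclidean space are pairs \<open>(x', x\<^sub>n)\<close>, and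
  the points of the target are pairs \<open>(y', t)\<close>. Only the values of \<open>q\<close> on \<open>\<Omega>\<close> matter.
\<close>

definition centers :: "('a \<Rightarrow> real) \<Rightarrow> 'a set \<Rightarrow> ('a \<times> real) set" where
  "centers q \<Omega> = {(y', q y') | y'. y' \<in> \<Omega>}"

definition surface_fun ::
  "real^'n^'n \<Rightarrow> real \<Rightarrow> (real^'n \<Rightarrow> real) \<Rightarrow> (real^'n) \<times> real \<Rightarrow> (real^'n) \<times> real \<Rightarrow> real" where
  "surface_fun A b q = (\<lambda>(y', t) (x', xn).
     t - (x' - y') \<bullet> (A *v (x' - y')) - b * (xn - q y'))"

definition radon_phase ::
  "real^'n^'n \<Rightarrow> real \<Rightarrow> (real^'n \<Rightarrow> real) \<Rightarrow> (real^'n) \<times> real \<Rightarrow> (real^'n) \<times> real \<Rightarrow> real \<Rightarrow> real" where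
  "radon_phase A b q y x \<omega> = \<omega> * surface_fun A b q y x"

text \<open>The Radon transform over the surfaces \<open>{x. surface_fun A b q (y', t) x = 0}\<close>.\<close>

definition radon_transform ::
  "real^'n^'n \<Rightarrow> real \<Rightarrow> (real^'n \<Rightarrow> real) \<Rightarrow> (real^'n) set
    \<Rightarrow> ((real^'n) \<times> real, (real^'n) \<times> real) osc_operator" where
  "radon_transform A b q \<Omega> =
     \<lparr>target_dom = \<Omega> \<times> {0<..},
      source_dom = - centers q \<Omega>,
      phase = radon_phase A b q,
      amplitude = (\<lambda>y x \<omega>. norm (gradient (\<lambda>x. radon_phase A b q y x \<omega>) x))\<rparr>"

lemma gradient_eqI: "gradient f x = d" if "GDERIV f x :> d"
  unfolding gradient_def
proof (rule the_equality)
  fix e assume "GDERIV f x :> e"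
  then have "(\<lambda>h. h \<bullet> e) = (\<lambda>h. h \<bullet> d)"
    using that has_derivative_unique unfolding gderiv_def by blast
  then have "(e - d) \<bullet> e = (e - d) \<bullet> d" by metis
  then have "(e - d) \<bullet> (e - d) = 0" by (simp add: inner_diff_right)
  then show "e = d" by simp
qed (fact that)

lemma GDERIV_gradient: "GDERIV f x :> gradient f x"
  if diff: "f differentiable (at x)" for f :: "'a::euclidean_space \<Rightarrow> real"
proof -
  obtain D where D: "(f has_derivative D) (at x)" using diff unfolding differentiable_def by blast
  then interpret linear D by (rule has_derivative_linear)
  have "D h = h \<bullet> (\<Sum>i\<in>Basis. D i *\<^sub>R i)" for h
  proof -
    have "D h = D (\<Sum>i\<in>Basis. (h \<bullet> i) *\<^sub>R i)" by (simp add: euclidean_representation)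
    also have "\<dots> = h \<bullet> (\<Sum>i\<in>Basis. D i *\<^sub>R i)"
      by (simp add: sum scale inner_sum_right mult.commute)
    finally show ?thesis .
  qed
  then have "D = (\<lambda>h. h \<bullet> (\<Sum>i\<in>Basis. D i *\<^sub>R i))" by blast
  then have "GDERIV f x :> (\<Sum>i\<in>Basis. D i *\<^sub>R i)"
    using D unfolding gderiv_def by simp
  then show ?thesis using gradient_eqI by metis
qed

lemma sym_inner: "u \<bullet> (A *v v) = v \<bullet> (A *v u)" if "transpose A = A" for A :: "real^'n^'n"
  by (metis dot_lmul_matrix inner_commute that transpose_matrix_vector)

lemma gradient_radon_phase_target:
  assumes A: "transpose A = A" and q: "q differentiable (at y')"
  shows "gradient (\<lambda>y. radon_phase A b q y (x', xn) \<omega>) (y', t)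
    = (\<omega> *\<^sub>R (2 *\<^sub>R (A *v (x' - y')) + b *\<^sub>R gradient q y'), \<omega>)"
proof (rule gradient_eqI)
  have q': "(q has_derivative (\<lambda>h. h \<bullet> gradient q y')) (at (fst (y', t)))"
    using GDERIV_gradient[OF q] unfolding gderiv_def by simp
  have fst': "(fst has_derivative fst) (at (y', t))"
    by (rule bounded_linear_imp_has_derivative[OF bounded_linear_fst])
  have 1: "((\<lambda>y. q (fst y)) has_derivative (\<lambda>h. fst h \<bullet> gradient q y')) (at (y', t))"
    using has_derivative_compose[OF fst' q'] .
  have 2: "((\<lambda>y. x' - fst y) has_derivative (\<lambda>h. - fst h)) (at (y', t))"
    by (auto intro!: derivative_eq_intros)
  have 3: "((\<lambda>y. A *v (x' - fst y)) has_derivative (\<lambda>h. A *v (- fst h))) (at (y', t))"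
    by (rule bounded_linear.has_derivative[OF matrix_vector_mul_bounded_linear 2])
  have 4: "(snd has_derivative snd) (at (y', t))"
    by (rule bounded_linear_imp_has_derivative[OF bounded_linear_snd])
  show "GDERIV (\<lambda>y. radon_phase A b q y (x', xn) \<omega>) (y', t)
    :> (\<omega> *\<^sub>R (2 *\<^sub>R (A *v (x' - y')) + b *\<^sub>R gradient q y'), \<omega>)"
    unfolding gderiv_def radon_phase_def surface_fun_def case_prod_unfold fst_conv snd_conv
    by (rule has_derivative_eq_rhs,
        (rule 1 2 3 4 has_derivative_mult_right has_derivative_diff has_derivative_inner
          has_derivative_const)+)
      (simp add: fun_eq_iff algebra_simps sym_inner[OF A] inner_commute[of "A *v _"]
        linear_neg[OF matrix_vector_mul_linear])
qed

lemma gradient_radon_phase_source: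
  assumes A: "transpose A = A"
  shows "gradient (\<lambda>x. radon_phase A b q (y', t) x \<omega>) (x', xn)
    = - (\<omega> *\<^sub>R (2 *\<^sub>R (A *v (x' - y')), b))"
proof (rule gradient_eqI)
  have 2: "((\<lambda>x. fst x - y') has_derivative (\<lambda>h. fst h)) (at (x', xn))"
    by (auto intro!: derivative_eq_intros)
  have 3: "((\<lambda>x. A *v (fst x - y')) has_derivative (\<lambda>h. A *v (fst h))) (at (x', xn))"
    by (rule bounded_linear.has_derivative[OF matrix_vector_mul_bounded_linear 2])
  have 4: "(snd has_derivative snd) (at (x', xn))"
    by (rule bounded_linear_imp_has_derivative[OF bounded_linear_snd])
  show "GDERIV (\<lambda>x. radon_phase A b q (y', t) x \<omega>) (x', xn)
    :> - (\<omega> *\<^sub>R (2 *\<^sub>R (A *v (x' - y')), b))"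
    unfolding gderiv_def radon_phase_def surface_fun_def case_prod_unfold fst_conv snd_conv
    by (rule has_derivative_eq_rhs,
        (rule 2 3 4 has_derivative_mult_right has_derivative_diff has_derivative_inner
          has_derivative_const)+)
      (simp add: fun_eq_iff algebra_simps sym_inner[OF A] inner_commute[of "A *v _"]
        linear_neg[OF matrix_vector_mul_linear])
qed

text \<open>The canonical relation of the Radon transform, parametrized by \<open>(y', x, \<omega>)\<close>.\<close>

lemma canonical_relation_radon_transform:
  assumes A: "transpose A = A" and q: "smooth_on q \<Omega>"
  shows "canonical_relation (radon_transform A b q \<Omega>) =
    {(((y', t), (\<omega> *\<^sub>R (2 *\<^sub>R (A *v (x' - y')) + b *\<^sub>R gradient q y'), \<omega>)),
      ((x', xn), \<omega> *\<^sub>R (2 *\<^sub>R (A *v (x' - y')), b))) | y' t x' xn \<omega>.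
        y' \<in> \<Omega> \<and> t = (x' - y') \<bullet> (A *v (x' - y')) + b * (xn - q y') \<and> t > 0 \<and>
        (x', xn) \<notin> centers q \<Omega> \<and> \<omega> \<noteq> 0}" (is "?L = ?R")
proof -
  have diff: "q differentiable (at y')" if "y' \<in> \<Omega>" for y'
    using q that unfolding smooth_on_def by (metis Ck_on.simps(2))
  have crit: "((\<lambda>\<omega>. radon_phase A b q (y', t) (x', xn) \<omega>) has_real_derivative 0) (at \<omega>)
      \<longleftrightarrow> t = (x' - y') \<bullet> (A *v (x' - y')) + b * (xn - q y')" for y' t x' xn \<omega>
  proof -
    have "((\<lambda>\<omega>. radon_phase A b q (y', t) (x', xn) \<omega>) has_real_derivative
        surface_fun A b q (y', t) (x', xn)) (at \<omega>)"
      unfolding radon_phase_def by (auto intro!: derivative_eq_intros)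
    then have "((\<lambda>\<omega>. radon_phase A b q (y', t) (x', xn) \<omega>) has_real_derivative 0) (at \<omega>)
        \<longleftrightarrow> surface_fun A b q (y', t) (x', xn) = 0"
      using DERIV_unique by metis
    then show ?thesis by (auto simp: surface_fun_def)
  qed
  have "?L = {((y, gradient (\<lambda>y. radon_phase A b q y x \<omega>) y),
        (x, - gradient (\<lambda>x. radon_phase A b q y x \<omega>) x)) | y x \<omega>.
        y \<in> \<Omega> \<times> {0<..} \<and> x \<in> - centers q \<Omega> \<and> \<omega> \<noteq> 0 \<and>
        ((\<lambda>\<omega>. radon_phase A b q y x \<omega>) has_real_derivative 0) (at \<omega>)}"
    unfolding canonical_relation_def radon_transform_def by simp
  also have "\<dots> = ?R"
  proof (intro subset_antisym subsetI, goal_cases)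
    case (1 p)
    then obtain y' t x' xn \<omega> where
      p: "p = (((y', t), gradient (\<lambda>y. radon_phase A b q y (x', xn) \<omega>) (y', t)),
             ((x', xn), - gradient (\<lambda>x. radon_phase A b q (y', t) x \<omega>) (x', xn)))"
      and y: "y' \<in> \<Omega>" "t > 0" "(x', xn) \<notin> centers q \<Omega>" "\<omega> \<noteq> 0"
      and c: "((\<lambda>\<omega>. radon_phase A b q (y', t) (x', xn) \<omega>) has_real_derivative 0) (at \<omega>)"
      by auto
    show ?case
      using y c[unfolded crit]
      unfolding p gradient_radon_phase_target[OF A diff[OF y(1)]] gradient_radon_phase_source[OF A]
        minus_minus by blast
  next
    case (2 p)
    then obtain y' t x' xn \<omega> where
      p: "p = (((y', t), (\<omega> *\<^sub>R (2 *\<^sub>R (A *v (x' - y')) + b *\<^sub>R gradient q y'), \<omega>)),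
             ((x', xn), \<omega> *\<^sub>R (2 *\<^sub>R (A *v (x' - y')), b)))"
      and y: "y' \<in> \<Omega>" "t > 0" "(x', xn) \<notin> centers q \<Omega>" "\<omega> \<noteq> 0"
      and c: "t = (x' - y') \<bullet> (A *v (x' - y')) + b * (xn - q y')"
      by blast
    have p': "p = (((y', t), gradient (\<lambda>y. radon_phase A b q y (x', xn) \<omega>) (y', t)),
             ((x', xn), - gradient (\<lambda>x. radon_phase A b q (y', t) x \<omega>) (x', xn)))"
      unfolding p gradient_radon_phase_target[OF A diff[OF y(1)]] gradient_radon_phase_source[OF A]
        minus_minus ..
    show ?case
      unfolding p' mem_Collect_eq
      by (rule exI[of _ "(y', t)"], rule exI[of _ "(x', xn)"], rule exI[of _ \<omega>])
        (use y c crit in auto)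
  qed
  finally show ?thesis .
qed

end

theory Submission
  imports Defs
begin

text \<open>
  Both halves of the Bolker condition hold for the same reason: the canonical relation is contained
  in the graph of a differentiable map \<open>G\<close> from its left projection to \<open>(x, \<xi>)\<close>, where
  \<open>\<xi> = \<omega> (2 A (x' - y'), b)\<close> is the covector at \<open>x\<close>. Injectivity of the projection of
  a graph is clear, and the velocity of a curve in the graph is determined by the velocity of its
  projection through the derivative of \<open>G\<close> (lemma
  \<open>inj_on_tangent_space_graph\<close>), so that the differential of the projection is injective on tangent
  vectors.

  The map \<open>G\<close> comes from solving the equations of the canonical relation for \<open>x\<close> and \<open>\<xi>\<close>. As
  \<open>\<omega> \<noteq> 0\<close> is a coordinate of the projection, the covector
  \<open>\<eta> = \<omega> (2 A (x' - y') + b \<nabla>q(y'))\<close> determines \<open>A (x' - y')\<close>. Invertibility of \<open>A\<close> then gives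
  \<open>x'\<close>, and because \<open>b \<noteq> 0\<close> the equation
  \<open>t = (x' - y') \<bullet> A (x' - y') + b (x\<^sub>n - q(y'))\<close> gives \<open>x\<^sub>n\<close>. The formulas involve \<open>q\<close>
  and \<open>\<nabla>q\<close>, which are differentiable since \<open>q\<close> is smooth.
\<close>

lemma frechet_derivative_fst: "frechet_derivative fst (at p) = fst"
  using frechet_derivative_at[OF bounded_linear_imp_has_derivative[OF bounded_linear_fst]] by metis

lemma Ck_on_const: "Ck_on k (\<lambda>_. c) U"
  by (induction k arbitrary: c) (auto simp: frechet_derivative_const)

lemma smooth_on_fst: "smooth_on fst UNIV"
  unfolding smooth_on_def
proof (intro conjI allI)
  fix k :: nat
  show "Ck_on k (fst :: 'a \<times> 'b \<Rightarrow> 'a) UNIV"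
  proof (cases k)
    case 0
    then show ?thesis by (auto intro!: continuous_intros)
  next
    case (Suc j)
    have "(fst :: 'a \<times> 'b \<Rightarrow> 'a) differentiable (at p)" for p
      by (rule bounded_linear_imp_differentiable[OF bounded_linear_fst])
    with Suc show ?thesis by (simp add: frechet_derivative_fst Ck_on_const)
  qed
qed simp

text \<open>
  A curve in the graph satisfies \<open>snd \<circ> \<gamma> = G \<circ> fst \<circ> \<gamma>\<close>. By the chain rule its velocity \<open>v\<close>
  satisfies \<open>snd v = G' (fst v)\<close>, where \<open>G'\<close> is the derivative of \<open>G\<close>, so \<open>v\<close> is determined by
  \<open>fst v\<close>. Since \<open>tangent_space M p\<close> need not be a vector space, a trivial kernel of \<open>fst\<close> on it
  would not be enough.
\<close>

lemma inj_on_tangent_space_graph: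
  assumes graph: "\<And>z. z \<in> M \<Longrightarrow> snd z = G (fst z)"
    and diff: "G differentiable (at (fst p))"
  shows "inj_on fst (tangent_space M p)"
proof -
  obtain G' where G': "(G has_derivative G') (at (fst p))"
    using diff unfolding differentiable_def by blast
  have snd_eq: "snd v = G' (fst v)" if v: "v \<in> tangent_space M p" for v
  proof -
    obtain \<gamma> :: "real \<Rightarrow> _" where \<gamma>: "\<gamma> 0 = p" "\<And>s. \<gamma> s \<in> M"
      and d: "(\<gamma> has_derivative (\<lambda>h. h *\<^sub>R v)) (at 0)"
      using v unfolding tangent_space_def has_vector_derivative_def by blast
    have 1: "((\<lambda>s. snd (\<gamma> s)) has_derivative (\<lambda>h. snd (h *\<^sub>R v))) (at 0)"
      by (rule has_derivative_snd[OF d])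
    have "((\<lambda>s. G (fst (\<gamma> s))) has_derivative (\<lambda>h. G' (fst (h *\<^sub>R v)))) (at 0)"
      by (rule has_derivative_compose[OF has_derivative_fst[OF d]]) (simp add: \<gamma> G')
    then have 2: "((\<lambda>s. snd (\<gamma> s)) has_derivative (\<lambda>h. G' (fst (h *\<^sub>R v)))) (at 0)"
      using graph \<gamma>(2) by simp
    have "(\<lambda>h. snd (h *\<^sub>R v)) = (\<lambda>h. G' (fst (h *\<^sub>R v)))"
      by (rule has_derivative_unique[OF 1 2])
    from fun_cong[OF this, of 1] show ?thesis by simp
  qed
  show ?thesis
    by (rule inj_onI) (simp add: prod_eq_iff snd_eq)
qed

lemma bolker_condition_if_graph:
  assumes "\<And>z. z \<in> canonical_relation R \<Longrightarrow> snd z = G (fst z)"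
    and "\<And>z. z \<in> canonical_relation R \<Longrightarrow> G differentiable (at (fst z))"
  shows "bolker_condition R"
  unfolding bolker_condition_def immersion_on_def left_projection_def frechet_derivative_fst
proof (intro conjI ballI)
  show "inj_on fst (canonical_relation R)"
    by (rule inj_onI) (metis assms(1) prod_eqI)
  show "\<exists>U. canonical_relation R \<subseteq> U \<and> smooth_on fst U"
    using smooth_on_fst by blast
  show "inj_on fst (tangent_space (canonical_relation R) p)"
    if "p \<in> canonical_relation R" for p
    using assms that by (intro inj_on_tangent_space_graph)
qed

text \<open>
  Smoothness controls the directional derivatives of \<open>q\<close>, so the gradient is expanded in the
  standard basis. The expansion is valid on \<open>U\<close>, which is enough near \<open>y\<close> because \<open>U\<close> is open.
\<close>

lemma differentiable_gradient:
  fixes q :: "'a::euclidean_space \<Rightarrow> real"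
  assumes q: "smooth_on q U" and y: "y \<in> U"
  shows "gradient q differentiable (at y)"
proof -
  have "open U" and C2: "Ck_on (Suc (Suc 0)) q U"
    using q unfolding smooth_on_def by blast+
  have eq: "gradient q z = (\<Sum>i\<in>Basis. frechet_derivative q (at z) i *\<^sub>R i)" if "z \<in> U" for z
  proof -
    have "q differentiable (at z)" using C2 that by simp
    then have "(q has_derivative (\<lambda>h. h \<bullet> gradient q z)) (at z)"
      using GDERIV_gradient unfolding gderiv_def by blast
    then have "frechet_derivative q (at z) = (\<lambda>h. h \<bullet> gradient q z)"
      using frechet_derivative_at by metis
    then show ?thesis
      by (simp add: inner_commute[of _ "gradient q z"] euclidean_representation)
  qed
  have "(\<lambda>z. \<Sum>i\<in>Basis. frechet_derivative q (at z) i *\<^sub>R i) differentiable (at y)"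
    using C2 y by (auto intro!: differentiable_sum differentiable_scaleR)
  then obtain D where
    "((\<lambda>z. \<Sum>i\<in>Basis. frechet_derivative q (at z) i *\<^sub>R i) has_derivative D) (at y)"
    unfolding differentiable_def by blast
  then have "(gradient q has_derivative D) (at y)"
    by (rule has_derivative_transform_within_open[OF _ \<open>open U\<close> y]) (simp add: eq)
  then show ?thesis unfolding differentiable_def by blast
qed

text \<open>
  The vector \<open>x' - y'\<close>, recovered from the covector \<open>\<eta> = \<omega> (2 A (x' - y') + b \<nabla>q(y'))\<close>.
\<close>

definition radon_displacement ::
  "real^'n^'n \<Rightarrow> real \<Rightarrow> (real^'n \<Rightarrow> real)
    \<Rightarrow> ((real^'n) \<times> real) \<times> ((real^'n) \<times> real) \<Rightarrow> real^'n" where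
  "radon_displacement A b q = (\<lambda>((y', t), (\<eta>, \<omega>)).
     matrix_inv A *v ((1 / 2) *\<^sub>R (inverse \<omega> *\<^sub>R \<eta> - b *\<^sub>R gradient q y')))"

text \<open>
  The map \<open>G\<close>: the value of \<open>(x, \<xi>)\<close> that the equations force for a given
  \<open>((y', t), (\<eta>, \<omega>))\<close> with \<open>\<omega> \<noteq> 0\<close>.
\<close>

definition radon_source ::
  "real^'n^'n \<Rightarrow> real \<Rightarrow> (real^'n \<Rightarrow> real)
    \<Rightarrow> ((real^'n) \<times> real) \<times> ((real^'n) \<times> real) \<Rightarrow> ((real^'n) \<times> real) \<times> ((real^'n) \<times> real)" where
  "radon_source A b q = (\<lambda>((y', t), (\<eta>, \<omega>)). let u = radon_displacement A b q ((y', t), (\<eta>, \<omega>)) in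
     ((y' + u, (t - u \<bullet> (A *v u)) / b + q y'), (\<eta> - (\<omega> * b) *\<^sub>R gradient q y', \<omega> * b)))"

lemma differentiable_fst:
  assumes "f differentiable F" shows "(\<lambda>x. fst (f x)) differentiable F"
  using assms unfolding differentiable_def by (blast intro: has_derivative_fst)

lemma differentiable_snd:
  assumes "f differentiable F" shows "(\<lambda>x. snd (f x)) differentiable F"
  using assms unfolding differentiable_def by (blast intro: has_derivative_snd)

lemma differentiable_matrix_vector_mult:
  fixes A :: "real^'n^'m"
  assumes "f differentiable F" shows "(\<lambda>x. A *v f x) differentiable F"
  using assms unfolding differentiable_def
  by (blast intro: bounded_linear.has_derivative[OF matrix_vector_mul_bounded_linear])

lemma differentiable_radon_source:
  assumes q: "smooth_on q \<Omega>" and y: "y' \<in> \<Omega>" and \<omega>: "\<omega> \<noteq> 0" and b: "b \<noteq> 0"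
  shows "radon_source A b q differentiable (at ((y', t), (\<eta>, \<omega>)))" (is "_ differentiable (at ?z)")
proof -
  have base: "(\<lambda>z. fst (fst z)) differentiable (at ?z)"
    by (intro differentiable_fst differentiable_ident)
  have "q differentiable (at y')"
    using q y unfolding smooth_on_def by (metis Ck_on.simps(2))
  then have dq: "(\<lambda>z. q (fst (fst z))) differentiable (at ?z)"
    using differentiable_chain_at[OF base] by (simp add: o_def)
  have dg: "(\<lambda>z. gradient q (fst (fst z))) differentiable (at ?z)"
    using differentiable_chain_at[OF base] differentiable_gradient[OF q y] by (simp add: o_def)
  have u: "radon_displacement A b q differentiable (at ?z)"
    unfolding radon_displacement_def case_prod_unfold
    by (intro differentiable_matrix_vector_mult differentiable_scaleR differentiable_diff
        differentiable_inverse differentiable_const differentiable_fst differentiable_snd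
        differentiable_ident dg) (simp add: \<omega>)
  have "(\<lambda>z. ((fst (fst z) + radon_displacement A b q z,
        (snd (fst z) - radon_displacement A b q z \<bullet> (A *v radon_displacement A b q z)) / b
          + q (fst (fst z))),
      (fst (snd z) - (snd (snd z) * b) *\<^sub>R gradient q (fst (fst z)), snd (snd z) * b)))
    differentiable (at ?z)"
    by (intro differentiable_Pair differentiable_add differentiable_diff differentiable_divide
        differentiable_inner differentiable_mult differentiable_scaleR
        differentiable_matrix_vector_mult differentiable_const differentiable_fst
        differentiable_snd differentiable_ident u dq dg b)
  then show ?thesis
    unfolding radon_source_def Let_def case_prod_unfold prod.collapse .
qed

lemma radon_displacement_eq:
  assumes A: "invertible A" and \<omega>: "\<omega> \<noteq> 0"
  shows "radon_displacement A b q
    ((y', t), (\<omega> *\<^sub>R (2 *\<^sub>R (A *v (x' - y')) + b *\<^sub>R gradient q y'), \<omega>)) = x' - y'"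
proof -
  have "matrix_inv A ** A = mat 1"
    using A someI_ex[of "\<lambda>B. A ** B = mat 1 \<and> B ** A = mat 1"]
    unfolding invertible_def matrix_inv_def by blast
  then have "matrix_inv A *v (A *v u) = u" for u
    by (simp add: matrix_vector_mul_assoc)
  then show ?thesis
    unfolding radon_displacement_def using \<omega> by simp
qed

lemma radon_source_eq:
  assumes A: "invertible A" and b: "b \<noteq> 0" and \<omega>: "\<omega> \<noteq> 0"
    and t: "t = (x' - y') \<bullet> (A *v (x' - y')) + b * (xn - q y')"
  shows "radon_source A b q
      ((y', t), (\<omega> *\<^sub>R (2 *\<^sub>R (A *v (x' - y')) + b *\<^sub>R gradient q y'), \<omega>))
    = ((x', xn), \<omega> *\<^sub>R (2 *\<^sub>R (A *v (x' - y')), b))"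
  unfolding radon_source_def Let_def prod.case radon_displacement_eq[OF A \<omega>]
  using b by (simp add: t) (simp add: algebra_simps)

theorem theorem7p1:
  fixes A :: "real^'n^'n" and b :: real
    and \<Omega> :: "(real^'n) set" and q :: "real^'n \<Rightarrow> real"
  assumes "transpose A = A" and "invertible A" and "b \<noteq> 0"
    and "open \<Omega>" and "smooth_on q \<Omega>"
  shows "bolker_condition (radon_transform A b q \<Omega>)"
proof (rule bolker_condition_if_graph)
  fix z assume "z \<in> canonical_relation (radon_transform A b q \<Omega>)"
  then obtain y' t x' xn \<omega> where
    z: "z = (((y', t), (\<omega> *\<^sub>R (2 *\<^sub>R (A *v (x' - y')) + b *\<^sub>R gradient q y'), \<omega>)),
      ((x', xn), \<omega> *\<^sub>R (2 *\<^sub>R (A *v (x' - y')), b)))"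
    and y: "y' \<in> \<Omega>" and \<omega>: "\<omega> \<noteq> 0"
    and t: "t = (x' - y') \<bullet> (A *v (x' - y')) + b * (xn - q y')"
    unfolding canonical_relation_radon_transform[OF assms(1,5)] by blast
  show "snd z = radon_source A b q (fst z)"
    unfolding z fst_conv snd_conv using radon_source_eq[OF assms(2,3) \<omega>, of t x' y' xn q] t by simp
  show "radon_source A b q differentiable (at (fst z))"
    unfolding z fst_conv by (rule differentiable_radon_source[OF assms(5) y \<omega> assms(3)])
qed

end
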